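(* Let $G=\langle V\cup\{s\},E\rangle$ be a weighted undirected graph with source $s$, edge costs $c_{(i,j)}\ge 0$, and budgets $B_i>0$ for $i\in V$. The saving-based cost sharing mechanism (SCSM) $(g,f,x)$ satisfies truthfulness: for every node $i\in V$, every type $\theta_i\in\Theta_i$, every report $\theta_i'\in\Theta_i$ with $\theta_i'\subseteq\theta_i$, and every profile $\theta_{-i}'\in\Theta_{-i}$ of the other nodes (including $s$) such that $i\in g(\theta_i,\theta_{-i}')\cap g(\theta_i',\theta_{-i}')$, $$x_i((\theta_i,\theta_{-i}'))\le x_i((\theta_i',\theta_{-i}')).$$
   Context: Setting. $G=\langle V\cup\{s\},E\rangle$ is a finite weighted undirected graph; $s$ is the source, each edge $(i,j)\in E$ has cost $c_{(i,j)}\ge 0$, and each node $i\in V$ has a public budget $B_i>0$. For $i\in V\cup\{s\}$, a type of $i$ is a set of edges of $E$ adjacent to $i$; $\Theta_i$ is the set of all such sets. $\Theta=\prod_{i\in V\cup\{s\}}\Theta_i$ and $\Theta_{-i}=\prod_{j\neq i}\Theta_j$. A node $i\in V$ with type $\theta_i$ may report any $\theta_i'\subseteq\theta_i$ (the source is not strategic). A report profile $\theta'\in\Theta$ induces the graph $G_{\theta'}=\langle V\cup\{s\},E_{\theta'}\rangle$ with $E_{\theta'}=\{(i,j)\in E : (i,j)\in\theta_i'\cap\theta_j'\}$. A cost sharing mechanism $(g,f,x)$ assigns to each $\theta'\in\Theta$ a set $g(\theta')\subseteq V$ of selected (connected) nodes, a set $f(\theta')\subseteq E_{\theta'}$ of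 selected edges connecting the nodes of $g(\theta')$ (to the source), and cost shares $x_i(\theta')\in\mathbb{R}$ for $i\in V$, with $x_i(\theta')=0$ if $i\notin g(\theta')$. Selection function $g^*(\theta',S)$, for $\theta'\in\Theta$ and $S\subseteq V$: start with $N=\{s\}$ and $\hat E=\{(p,q)\in E_{\theta'}: p\in N, q\in S\}$. While $\hat E\ne\emptyset$: take an edge $(i,j)\in\hat E$ of smallest cost, with $i\in N$, $j\in S\setminus N$; if $B_j\ge c_{(i,j)}$, replace $N$ by $N\cup\{j\}$ and reset $\hat E=\{(p,q)\in E_{\theta'}: p\in N, q\in S\setminus N\}$; otherwise delete $(i,j)$ from $\hat E$. Output $g^*(\theta',S)=N\setminus\{s\}$. SCSM. Given $\theta'\in\Theta$, set $g(\theta')=g^*(\theta',V)$. For each $S\subseteq g(\theta')$ let $S'=g^*(\theta',S)$ and $v(S)=\sum_{i\in S'}B_i-C(S')$, where $C(S')$ is the minimal cost of connecting $S'$ to $s$ using only nodes of $S'\cup\{s\}$, i.e. the cost of a minimum spanning tree of the subgraph of $G_{\theta'}$ induced by $S'\cup\{s\}$. For $i\in g(\theta')$ let $$\phi_i=\sum_{S\subseteq g(\theta')\setminus\{i\}}\frac{|S|!\,(|g(\theta')|-|S|-1)!}{|g(\theta')|!}\,\bigl(v(S\cup\{i\})-v(S)\bigr),\qquad x_i(\theta')=B_i-\phi_i,$$ and $x_i(\theta')=0$ for $i\in V\setminus g(\theta')$. Finally $f(\theta')$ is the edge set of a minimum spanning tree of the subgraph of $G_{\theta'}$ induced by $g(\theta')\cup\{s\}$.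 *)

theory Defs
  imports Complex_Main "HOL-Library.FuncSet"
begin

section \<open>Graphs with a source, edge costs and budgets\<close>

text \<open>
  Undirected edges are two-element sets, so that \<open>{i, j}\<close> stands for \<open>(i, j) = (j, i)\<close>.
  The node set is \<open>insert s V\<close>.
\<close>

locale budgeted_graph =
  fixes V :: "'a set" and s :: 'a and E :: "'a set set"
    and c :: "'a set \<Rightarrow> real" and B :: "'a \<Rightarrow> real"
  assumes finite_V: "finite V"
    and source: "s \<notin> V"
    and edges: "\<And>e. e \<in> E \<Longrightarrow> e \<subseteq> insert s V \<and> card e = 2"
    and cost_nonneg: "\<And>e. e \<in> E \<Longrightarrow> 0 \<le> c e"
    and budget_pos: "\<And>i. i \<in> V \<Longrightarrow> 0 < B i"

definition types :: "'a set set \<Rightarrow> 'a \<Rightarrow> 'a set set set" where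
  "types E i = Pow {e \<in> E. i \<in> e}"

definition profiles :: "'a set \<Rightarrow> 'a \<Rightarrow> 'a set set \<Rightarrow> ('a \<Rightarrow> 'a set set) set" where
  "profiles V s E = (\<Pi>\<^sub>E i \<in> insert s V. types E i)"

definition profiles_except :: "'a set \<Rightarrow> 'a \<Rightarrow> 'a set set \<Rightarrow> 'a \<Rightarrow> ('a \<Rightarrow> 'a set set) set" where
  "profiles_except V s E i = (\<Pi>\<^sub>E j \<in> insert s V - {i}. types E j)"

definition reported_edges :: "'a set set \<Rightarrow> ('a \<Rightarrow> 'a set set) \<Rightarrow> 'a set set" where
  "reported_edges E \<theta> = {{i, j} | i j. {i, j} \<in> E \<and> {i, j} \<in> \<theta> i \<inter> \<theta> j}"

section \<open>Minimum spanning trees\<close>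

definition induced_edges :: "'a set set \<Rightarrow> 'a set \<Rightarrow> 'a set set" where
  "induced_edges F W = {e \<in> F. e \<subseteq> W}"

definition connects :: "'a set set \<Rightarrow> 'a set \<Rightarrow> bool" where
  "connects T W \<longleftrightarrow> (\<forall>u\<in>W. \<forall>v\<in>W. (u, v) \<in> {(a, b). {a, b} \<in> T}\<^sup>*)"

definition is_cycle :: "'a set set \<Rightarrow> 'a list \<Rightarrow> bool" where
  "is_cycle T p \<longleftrightarrow> 3 \<le> length p \<and> distinct p \<and>
     (\<forall>k < length p. {p ! k, p ! (Suc k mod length p)} \<in> T)"

definition spanning_tree :: "'a set set \<Rightarrow> 'a set \<Rightarrow> 'a set set \<Rightarrow> bool" where
  "spanning_tree F W T \<longleftrightarrow> T \<subseteq> induced_edges F W \<and> connects T W \<and> \<not> (\<exists>p. is_cycle T p)"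

definition is_mst :: "('a set \<Rightarrow> real) \<Rightarrow> 'a set set \<Rightarrow> 'a set \<Rightarrow> 'a set set \<Rightarrow> bool" where
  "is_mst c F W T \<longleftrightarrow> spanning_tree F W T \<and>
     (\<forall>T'. spanning_tree F W T' \<longrightarrow> (\<Sum>e\<in>T. c e) \<le> (\<Sum>e\<in>T'. c e))"

definition mst_cost :: "('a set \<Rightarrow> real) \<Rightarrow> 'a set set \<Rightarrow> 'a set \<Rightarrow> real" where
  "mst_cost c F W = Min {\<Sum>e\<in>T. c e | T. spanning_tree F W T}"

section \<open>The selection function\<close>

definition edges_between :: "'a set set \<Rightarrow> 'a set \<Rightarrow> 'a set \<Rightarrow> 'a set set" where
  "edges_between F P Q = {{p, q} | p q. p \<in> P \<and> q \<in> Q \<and> {p, q} \<in> F}"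

text \<open>
  The loop states \<open>(N, H)\<close> (\<open>H\<close> is the set of candidate edges) that a run on the edge set \<open>F\<close>
  and the node set \<open>S\<close> can reach. A cheapest candidate need not be unique, and the choice among
  them is left open, so this is a nondeterministic transition system.
\<close>

inductive selection_state ::
  "'a \<Rightarrow> ('a set \<Rightarrow> real) \<Rightarrow> ('a \<Rightarrow> real) \<Rightarrow> 'a set set \<Rightarrow> 'a set \<Rightarrow> 'a set \<Rightarrow> 'a set set \<Rightarrow> bool"
  for s c B F S
where
  start: "selection_state s c B F S {s} (edges_between F {s} S)"
| add: "\<lbrakk>selection_state s c B F S N H; {i, j} \<in> H; \<forall>e\<in>H. c {i, j} \<le> c e; i \<in> N; j \<in> S - N;
         c {i, j} \<le> B j\<rbrakk>
        \<Longrightarrow> selection_state s c B F S (insert j N) (edges_between F (insert j N) (S - insert j N))"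
| delete: "\<lbrakk>selection_state s c B F S N H; {i, j} \<in> H; \<forall>e\<in>H. c {i, j} \<le> c e; i \<in> N; j \<in> S - N;
         \<not> c {i, j} \<le> B j\<rbrakk>
        \<Longrightarrow> selection_state s c B F S N (H - {{i, j}})"

definition selection_output ::
  "'a \<Rightarrow> ('a set \<Rightarrow> real) \<Rightarrow> ('a \<Rightarrow> real) \<Rightarrow> 'a set set \<Rightarrow> 'a set \<Rightarrow> 'a set \<Rightarrow> bool" where
  "selection_output s c B F S A \<longleftrightarrow> (\<exists>N. selection_state s c B F S N {} \<and> A = N - {s})"

text \<open>\<open>sel\<close> is the selection function under some way of breaking ties.\<close>

definition selection_function ::
  "'a set \<Rightarrow> 'a \<Rightarrow> 'a set set \<Rightarrow> ('a set \<Rightarrow> real) \<Rightarrow> ('a \<Rightarrow> real)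
   \<Rightarrow> (('a \<Rightarrow> 'a set set) \<Rightarrow> 'a set \<Rightarrow> 'a set) \<Rightarrow> bool" where
  "selection_function V s E c B sel \<longleftrightarrow>
     (\<forall>\<theta>\<in>profiles V s E. \<forall>S\<subseteq>V. selection_output s c B (reported_edges E \<theta>) S (sel \<theta> S))"

section \<open>The saving-based cost sharing mechanism\<close>

definition shapley :: "'a set \<Rightarrow> ('a set \<Rightarrow> real) \<Rightarrow> 'a \<Rightarrow> real" where
  "shapley A v i = (\<Sum>S \<in> Pow (A - {i}).
     fact (card S) * fact (card A - card S - 1) / fact (card A) * (v (S \<union> {i}) - v S))"

definition saving ::
  "'a \<Rightarrow> 'a set set \<Rightarrow> ('a set \<Rightarrow> real) \<Rightarrow> ('a \<Rightarrow> real)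
   \<Rightarrow> (('a \<Rightarrow> 'a set set) \<Rightarrow> 'a set \<Rightarrow> 'a set) \<Rightarrow> ('a \<Rightarrow> 'a set set) \<Rightarrow> 'a set \<Rightarrow> real" where
  "saving s E c B sel \<theta> S =
     (\<Sum>i \<in> sel \<theta> S. B i) - mst_cost c (reported_edges E \<theta>) (insert s (sel \<theta> S))"

text \<open>
  A minimum spanning tree need not be unique either, so SCSM is a predicate on mechanisms that
  is meant to hold for every way of breaking ties.
\<close>

definition SCSM ::
  "'a set \<Rightarrow> 'a \<Rightarrow> 'a set set \<Rightarrow> ('a set \<Rightarrow> real) \<Rightarrow> ('a \<Rightarrow> real)
   \<Rightarrow> (('a \<Rightarrow> 'a set set) \<Rightarrow> 'a set) \<Rightarrow> (('a \<Rightarrow> 'a set set) \<Rightarrow> 'a set set)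
   \<Rightarrow> (('a \<Rightarrow> 'a set set) \<Rightarrow> 'a \<Rightarrow> real) \<Rightarrow> bool" where
  "SCSM V s E c B g f x \<longleftrightarrow>
     (\<exists>sel. selection_function V s E c B sel \<and>
       (\<forall>\<theta>\<in>profiles V s E.
          g \<theta> = sel \<theta> V \<and>
          is_mst c (reported_edges E \<theta>) (insert s (g \<theta>)) (f \<theta>) \<and>
          (\<forall>i\<in>V. x \<theta> i =
             (if i \<in> g \<theta> then B i - shapley (g \<theta>) (saving s E c B sel \<theta>) i else 0))))"

end

(* Whatever the tie-breaking, the selected set is the set of nodes that can be reached from the
   source through affordable edges. Hence it grows with the reported edges, and so does the saving
   v(S): a minimum spanning tree of the smaller selected set extends by leaves, each costing at most
   the budget of the node it attaches. A report of i only affects edges at i, so a larger report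
   leaves v(S) unchanged for S without i and raises v(S + i); all marginal contributions of i grow.
   The additional nodes of g under the larger report are null players of the game under the smaller
   one, and null players do not affect Shapley values. *)

theory Submission
  imports Defs
begin

section \<open>The Shapley value\<close>

text \<open>Once a further player exists, a coalition of size \<open>k\<close> among
  \<open>n\<close> players splits into one of size \<open>k\<close> and one of size
  \<open>Suc k\<close>. Over the denominator \<open>fact (Suc n)\<close> the two numerators add up
  to \<open>k! (n - k - 1)! (n + 1)\<close>.\<close>

lemma shapley_weight_split:
  assumes "k < n"
  shows "fact k * fact (Suc n - k - 1) / fact (Suc n)
       + fact (Suc k) * fact (Suc n - Suc k - 1) / fact (Suc n)
       = (fact k * fact (n - k - 1) / fact n :: real)"
proof -
  \<comment> \<open>Here \<open>m\<close> is \<open>n - k - 1\<close>; naming it removes truncated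
    subtraction from the factorials.\<close>
  obtain m where n: "n = Suc (k + m)"
    using assms less_imp_Suc_add by blast
  have "fact (Suc n - k - 1) = (1 + real m) * fact m"
    using n by simp
  moreover have "fact (Suc n) = (2 + real k + real m) * (fact n :: real)"
    using n by (simp add: algebra_simps)
  moreover have "2 + real k + real m \<noteq> 0" by linarith
  ultimately show ?thesis
    using n by (simp add: divide_simps del: fact_Suc) (simp add: algebra_simps)
qed

text \<open>Pair each coalition \<open>S\<close> avoiding \<open>i\<close> and \<open>k\<close> with
  \<open>insert k S\<close>. Both give \<open>i\<close> the same marginal contribution, so their
  weights merge by \<open>shapley_weight_split\<close>.\<close>

lemma shapley_insert_null:
  assumes A: "finite A" "i \<in> A" "k \<notin> A"
    and null: "\<And>S. S \<subseteq> A \<Longrightarrow> v (insert k S) = v S"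
  shows "shapley (insert k A) v i = shapley A v i"
proof -
  define w where "w n m = (fact m * fact (n - m - 1) / fact n :: real)" for n m :: nat
  define M where "M S = v (S \<union> {i}) - v S" for S
  let ?P = "Pow (A - {i})"
  have diff: "insert k A - {i} = insert k (A - {i})" using A by auto
  have k: "k \<notin> A - {i}" using A by auto
  have fin: "finite ?P" using A by auto
  have inj: "inj_on (insert k) ?P"
    using k by (auto simp: inj_on_def)
  have disj: "?P \<inter> insert k ` ?P = {}" using k by auto
  have "shapley (insert k A) v i = (\<Sum>S \<in> ?P \<union> insert k ` ?P. w (Suc (card A)) (card S) * M S)"
    unfolding shapley_def diff Pow_insert w_def M_def using A by simp
  also have "\<dots> = (\<Sum>S\<in>?P. w (Suc (card A)) (card S) * M S)
      + (\<Sum>S\<in>?P. w (Suc (card A)) (card (insert k S)) * M (insert k S))"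
    using fin disj by (simp add: sum.union_disjoint sum.reindex[OF inj])
  also have "\<dots> = (\<Sum>S\<in>?P. w (card A) (card S) * M S)"
    unfolding sum.distrib[symmetric]
  proof (rule sum.cong[OF refl])
    fix S assume S: "S \<in> ?P"
    then have "finite S" "k \<notin> S" using A finite_subset by auto
    then have card: "card (insert k S) = Suc (card S)" by simp
    have "S \<subset> A" using S A by auto
    then have "card S < card A" using A psubset_card_mono by blast
    then have w: "w (card A) (card S) = w (Suc (card A)) (card S) + w (Suc (card A)) (Suc (card S))"
      using shapley_weight_split unfolding w_def by metis
    have "v (insert k S) = v S" "v (insert k (S \<union> {i})) = v (S \<union> {i})"
      using S A by (intro null; auto)+
    then have "M (insert k S) = M S" by (simp add: M_def insert_commute)
    then show "w (Suc (card A)) (card S) * M S + w (Suc (card A)) (card (insert k S)) * M (insert k S)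
        = w (card A) (card S) * M S"
      unfolding card w by (simp add: algebra_simps)
  qed
  finally show ?thesis unfolding shapley_def w_def M_def .
qed

text \<open>Since \<open>v\<close> only sees \<open>A'\<close>, each player of \<open>A - A'\<close>
  is null. Starting from \<open>A'\<close>, these players are added back one at a time.\<close>

lemma shapley_carrier:
  assumes "finite A" "A' \<subseteq> A" "i \<in> A'"
    and carrier: "\<And>S. S \<subseteq> A \<Longrightarrow> v (S \<inter> A') = v S"
  shows "shapley A v i = shapley A' v i"
proof -
  have "shapley (A' \<union> D) v i = shapley A' v i" if "finite D" "D \<subseteq> A - A'" for D
    using that
  proof (induction D rule: finite_induct)
    case (insert k D)
    have "finite A'" using assms finite_subset by auto
    have "shapley (insert k (A' \<union> D)) v i = shapley (A' \<union> D) v i"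
    proof (rule shapley_insert_null)
      fix S assume "S \<subseteq> A' \<union> D"
      then have "insert k S \<subseteq> A" "S \<subseteq> A" "insert k S \<inter> A' = S \<inter> A'"
        using insert assms by auto
      then show "v (insert k S) = v S" using carrier by metis
    qed (use insert assms \<open>finite A'\<close> in auto)
    then show ?case using insert by simp
  qed simp
  from this[of "A - A'"] show ?thesis
    using assms by (simp add: Un_absorb1)
qed

lemma shapley_mono:
  assumes "\<And>S. S \<subseteq> A - {i} \<Longrightarrow> v (S \<union> {i}) - v S \<le> v' (S \<union> {i}) - v' S"
  shows "shapley A v i \<le> shapley A v' i"
  unfolding shapley_def using assms by (intro sum_mono mult_left_mono) auto

section \<open>Selection as affordable reachability\<close>

text \<open>A description of the final \<open>N\<close> of the selection loop without order or ties.
  An edge is tested against the budget of the newly reached endpoint only, so the steps are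
  directed.\<close>

inductive_set affordable_reach ::
  "'a \<Rightarrow> ('a set \<Rightarrow> real) \<Rightarrow> ('a \<Rightarrow> real) \<Rightarrow> 'a set set \<Rightarrow> 'a set \<Rightarrow> 'a set"
  for s c B F S
where
  source: "s \<in> affordable_reach s c B F S"
| step: "\<lbrakk>i \<in> affordable_reach s c B F S; j \<in> S; {i, j} \<in> F; c {i, j} \<le> B j\<rbrakk>
    \<Longrightarrow> j \<in> affordable_reach s c B F S"

lemma affordable_reach_subset: "affordable_reach s c B F S \<subseteq> insert s S"
proof
  fix u assume "u \<in> affordable_reach s c B F S"
  then show "u \<in> insert s S" by induction auto
qed

text \<open>Paths never leave \<open>insert s S\<close>, so only the edges of \<open>F\<close>
  inside that set must survive in \<open>F'\<close>. This local form allows the edges at any node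
  outside \<open>insert s S\<close> to differ.\<close>

lemma affordable_reach_mono:
  assumes "S \<subseteq> S'" "induced_edges F (insert s S) \<subseteq> F'"
  shows "affordable_reach s c B F S \<subseteq> affordable_reach s c B F' S'"
proof
  fix u assume "u \<in> affordable_reach s c B F S"
  then show "u \<in> affordable_reach s c B F' S'"
  proof induction
    case (step i j)
    then have "{i, j} \<in> induced_edges F (insert s S)"
      using affordable_reach_subset[of s c B F S] by (auto simp: induced_edges_def)
    with step assms show ?case by (blast intro: affordable_reach.step)
  qed (rule affordable_reach.source)
qed

text \<open>A node of \<open>S\<close> that cannot be reached through the larger \<open>S'\<close>
  cannot be reached through \<open>S\<close> either, so dropping it changes nothing. This later
  turns the selected nodes into a carrier of the saving game.\<close>

lemma affordable_reach_restrict: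
  assumes "S \<subseteq> S'"
  shows "affordable_reach s c B F (S \<inter> affordable_reach s c B F S') = affordable_reach s c B F S"
proof
  show "affordable_reach s c B F (S \<inter> affordable_reach s c B F S') \<subseteq> affordable_reach s c B F S"
    by (rule affordable_reach_mono) (auto simp: induced_edges_def)
  have sub: "affordable_reach s c B F S \<subseteq> affordable_reach s c B F S'"
    using assms by (rule affordable_reach_mono) (auto simp: induced_edges_def)
  show "affordable_reach s c B F S \<subseteq> affordable_reach s c B F (S \<inter> affordable_reach s c B F S')"
  proof
    fix u assume "u \<in> affordable_reach s c B F S"
    then show "u \<in> affordable_reach s c B F (S \<inter> affordable_reach s c B F S')"
    proof induction
      case (step i j)
      then have "j \<in> affordable_reach s c B F S'"
        using sub by (blast intro: affordable_reach.step)
      with step show ?case by (blast intro: affordable_reach.step)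
    qed (rule affordable_reach.source)
  qed
qed

text \<open>The last conjunct is the point: deletion discards only unaffordable edges, so every
  affordable edge leaving \<open>N\<close> is still a candidate. For \<open>H = {}\<close> it makes
  \<open>N\<close> closed under \<open>affordable_reach.step\<close>.\<close>

lemma selection_state_invariant:
  assumes "selection_state s c B F S N H"
  shows "H \<subseteq> F \<and> s \<in> N \<and> N \<subseteq> affordable_reach s c B F S \<and>
    (\<forall>i\<in>N. \<forall>j\<in>S - N. {i, j} \<in> F \<longrightarrow> c {i, j} \<le> B j \<longrightarrow> {i, j} \<in> H)"
  using assms
proof induction
  case start
  then show ?case by (auto simp: edges_between_def intro: affordable_reach.source)
next
  case (add N H i j)
  then have "j \<in> affordable_reach s c B F S" by (blast intro: affordable_reach.step)
  moreover have "edges_between F P Q \<subseteq> F" for P Q by (auto simp: edges_between_def)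
  moreover have "{p, q} \<in> edges_between F P Q" if "p \<in> P" "q \<in> Q" "{p, q} \<in> F" for p q P Q
    using that by (auto simp: edges_between_def)
  ultimately show ?case using add by auto
next
  case (delete N H i j)
  \<comment> \<open>Edges being sets, the deleted one might be read in the other direction, where
    another budget applies. That exactly one endpoint lies in \<open>N\<close> rules this
    out.\<close>
  have "{p, q} \<noteq> {i, j}" if "p \<in> N" "q \<in> S - N" "c {p, q} \<le> B q" for p q
    using that delete by (auto simp: doubleton_eq_iff)
  with delete show ?case by auto
qed

lemma selection_output_eq:
  assumes "selection_output s c B F S A"
  shows "A = affordable_reach s c B F S - {s}"
proof -
  obtain N where "selection_state s c B F S N {}" and A: "A = N - {s}"
    using assms by (auto simp: selection_output_def)
  then have inv: "s \<in> N" "N \<subseteq> affordable_reach s c B F S"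
    and closed: "\<And>i j. \<lbrakk>i \<in> N; j \<in> S; {i, j} \<in> F; c {i, j} \<le> B j\<rbrakk> \<Longrightarrow> j \<in> N"
    using selection_state_invariant[of s c B F S N "{}"] by auto
  have "u \<in> N" if "u \<in> affordable_reach s c B F S" for u
    using that by induction (use inv closed in auto)
  with inv A show ?thesis by auto
qed

section \<open>Extending spanning trees\<close>

text \<open>All edges of \<open>T\<close> stay inside \<open>W\<close>, so the new node
  \<open>j\<close> has \<open>i\<close> as its only neighbour, whereas a node on a cycle has two
  distinct ones.\<close>

lemma spanning_tree_insert_leaf:
  assumes tree: "spanning_tree F W T" and ij: "{i, j} \<in> F" "i \<in> W" "j \<notin> W"
  shows "spanning_tree F (insert j W) (insert {i, j} T)"
proof -
  have sub: "\<And>e. e \<in> T \<Longrightarrow> e \<in> F \<and> e \<subseteq> W"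
    using tree by (auto simp: spanning_tree_def induced_edges_def)
  let ?R = "{(a, b). {a, b} \<in> T}" and ?R' = "{(a, b). {a, b} \<in> insert {i, j} T}"
  have R: "(u, v) \<in> ?R'\<^sup>*" if "u \<in> W" "v \<in> W" for u v
  proof -
    have "(u, v) \<in> ?R\<^sup>*" using tree that by (auto simp: spanning_tree_def connects_def)
    moreover have "?R\<^sup>* \<subseteq> ?R'\<^sup>*" by (rule rtrancl_mono) auto
    ultimately show ?thesis by blast
  qed
  have e: "(i, j) \<in> ?R'" "(j, i) \<in> ?R'" by (auto simp: insert_commute)
  have "connects (insert {i, j} T) (insert j W)"
    unfolding connects_def
  proof (intro ballI)
    fix u v assume uv: "u \<in> insert j W" "v \<in> insert j W"
    have "(u, i) \<in> ?R'\<^sup>*" using uv(1) R ij(2) e by auto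
    moreover have "(i, v) \<in> ?R'\<^sup>*" using uv(2) R ij(2) e by auto
    ultimately show "(u, v) \<in> ?R'\<^sup>*" by (rule rtrancl_trans)
  qed
  moreover have "\<not> is_cycle (insert {i, j} T) p" for p
  proof
    assume cyc: "is_cycle (insert {i, j} T) p"
    define n where "n = length p"
    have n: "3 \<le> n" and dist: "distinct p"
      and edge: "\<And>k. k < n \<Longrightarrow> {p ! k, p ! (Suc k mod n)} \<in> insert {i, j} T"
      using cyc by (auto simp: is_cycle_def n_def)
    have nb: "a = i" if "{a, j} \<in> insert {i, j} T" "a \<noteq> j" for a
      using that sub ij by (auto simp: doubleton_eq_iff)
    have "j \<notin> set p"
    proof
      assume "j \<in> set p"
      then obtain k where k: "k < n" "p ! k = j" by (auto simp: in_set_conv_nth n_def)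
      \<comment> \<open>The cyclic successor and predecessor positions of \<open>k\<close>; they
        differ because \<open>n\<close> is at least 3.\<close>
      let ?q = "Suc k mod n" and ?r = "(if k = 0 then n - 1 else k - 1)"
      have qr: "?q < n" "?r < n" "?q \<noteq> k" "?r \<noteq> k" "?q \<noteq> ?r" "Suc ?r mod n = k"
        using n k by (auto simp: mod_Suc)
      have "p ! ?q \<noteq> j" "p ! ?r \<noteq> j" "p ! ?q \<noteq> p ! ?r"
        using dist qr k nth_eq_iff_index_eq[OF dist] by (auto simp: n_def)
      moreover have "p ! ?q = i"
        using edge[OF k(1)] k(2) calculation nb[of "p ! ?q"] by (simp add: insert_commute)
      moreover have "p ! ?r = i"
        using edge[OF qr(2)] k(2) calculation(2) nb[of "p ! ?r"] unfolding qr(6) by simp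
      ultimately show False by simp
    qed
    have "{p ! k, p ! (Suc k mod n)} \<in> T" if "k < n" for k
    proof -
      have "j \<noteq> p ! k" "j \<noteq> p ! (Suc k mod n)"
        using \<open>j \<notin> set p\<close> that nth_mem[of _ p] n unfolding n_def
        by (metis, metis mod_less_divisor not_less_zero gr_zeroI)
      with edge[OF that] show ?thesis by (auto simp: doubleton_eq_iff)
    qed
    then have "is_cycle T p" using n dist by (simp add: is_cycle_def n_def)
    with tree show False by (auto simp: spanning_tree_def)
  qed
  ultimately show ?thesis
    using sub ij by (auto simp: spanning_tree_def induced_edges_def)
qed

lemma spanning_tree_singleton: "spanning_tree F {s} {}"
proof -
  have "\<not> is_cycle {} p" for p :: "'a list"
    by (auto simp: is_cycle_def intro!: exI[of _ 0])
  then show ?thesis by (simp add: spanning_tree_def connects_def)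
qed

text \<open>While \<open>W\<close> is not the whole reachable set, some affordable edge leaves it,
  and attaching its endpoint as a leaf costs at most the budget of that endpoint. The induction is
  on the number of missing nodes.\<close>

lemma spanning_tree_extend:
  assumes fin: "finite S" "finite F"
    and tree: "spanning_tree F W T" and W: "s \<in> W" "W \<subseteq> affordable_reach s c B F S"
  shows "\<exists>T'. spanning_tree F (affordable_reach s c B F S) T' \<and>
    sum c T' \<le> sum c T + sum B (affordable_reach s c B F S - W)"
  using tree W
proof (induction "card (affordable_reach s c B F S - W)" arbitrary: W T rule: less_induct)
  case less
  let ?R = "affordable_reach s c B F S"
  have finR: "finite ?R" using fin affordable_reach_subset[of s c B F S] finite_subset by blast
  show ?case
  proof (cases "W = ?R")
    case True
    with less show ?thesis by auto
  next
    case False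
    \<comment> \<open>Otherwise \<open>W\<close>, which contains \<open>s\<close>, would be closed
      under \<open>affordable_reach.step\<close> and hence contain every reachable node.\<close>
    have "\<exists>i j. i \<in> W \<and> j \<in> S - W \<and> {i, j} \<in> F \<and> c {i, j} \<le> B j"
    proof (rule ccontr)
      assume no: "\<not> ?thesis"
      have "u \<in> W" if "u \<in> ?R" for u
        using that by induction (use no less.prems in auto)
      with False less.prems show False by auto
    qed
    then obtain i j where ij: "i \<in> W" "j \<in> S" "j \<notin> W" "{i, j} \<in> F" "c {i, j} \<le> B j"
      by auto
    have j: "j \<in> ?R" using ij less.prems by (blast intro: affordable_reach.step)
    let ?W = "insert j W" and ?T = "insert {i, j} T"
    have TF: "T \<subseteq> F" and TW: "\<And>e. e \<in> T \<Longrightarrow> e \<subseteq> W"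
      using less.prems by (auto simp: spanning_tree_def induced_edges_def)
    have "finite T" "{i, j} \<notin> T" using TF TW fin ij finite_subset by auto
    then have sumT: "sum c ?T = c {i, j} + sum c T" by simp
    have RW: "?R - ?W = (?R - W) - {j}" and "j \<in> ?R - W" using ij j by blast+
    then have sumB: "sum B (?R - W) = B j + sum B (?R - ?W)"
      and "card (?R - ?W) < card (?R - W)"
      unfolding RW using finR by (auto intro: sum.remove card_Diff1_less simp del: card_Diff_singleton card_Diff_insert)
    moreover have "s \<in> ?W" "?W \<subseteq> ?R" using less.prems j by blast+
    ultimately obtain T' where "spanning_tree F ?R T'" "sum c T' \<le> sum c ?T + sum B (?R - ?W)"
      using less.hyps[of ?W ?T] spanning_tree_insert_leaf[OF less.prems(1) ij(4,1,3)] by blast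
    with sumT sumB ij(5) show ?thesis by auto
  qed
qed

section \<open>Spanning tree costs and their minimum\<close>

lemma finite_spanning_tree_costs:
  assumes "finite F"
  shows "finite {\<Sum>e\<in>T. c e | T. spanning_tree F W T}"
proof (rule finite_subset)
  show "{\<Sum>e\<in>T. c e | T. spanning_tree F W T} \<subseteq> sum c ` Pow F"
    by (auto simp: spanning_tree_def induced_edges_def)
qed (use assms in simp)

lemma mst_cost_le:
  assumes "finite F" "spanning_tree F W T"
  shows "mst_cost c F W \<le> sum c T"
  unfolding mst_cost_def using assms finite_spanning_tree_costs by (intro Min_le) auto

text \<open>The given tree makes the set under \<open>Min\<close> nonempty, so
  \<open>mst_cost\<close> is a genuine minimum rather than an unspecified value.\<close>

lemma mst_cost_attained:
  assumes "finite F" "spanning_tree F W T"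
  obtains T' where "spanning_tree F W T'" "sum c T' = mst_cost c F W"
proof -
  have "mst_cost c F W \<in> {\<Sum>e\<in>T. c e | T. spanning_tree F W T}"
    unfolding mst_cost_def using assms finite_spanning_tree_costs by (intro Min_in) auto
  with that show ?thesis by auto
qed

section \<open>Monotonicity of the saving\<close>

text \<open>This is \<open>saving\<close> with the selection replaced by reachability, so it depends
  on the reported edges and not on \<open>sel\<close>. As \<open>s\<close> is always reachable, the
  tree ranges over the reachable set itself.\<close>

definition reach_saving ::
  "'a \<Rightarrow> ('a set \<Rightarrow> real) \<Rightarrow> ('a \<Rightarrow> real) \<Rightarrow> 'a set set \<Rightarrow> 'a set \<Rightarrow> real" where
  "reach_saving s c B F S =
     sum B (affordable_reach s c B F S - {s}) - mst_cost c F (affordable_reach s c B F S)"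

text \<open>An optimal tree for \<open>F\<close> is still a spanning tree of the same nodes in
  \<open>F'\<close> and extends to the newly reached ones; their budgets cover the extra
  cost.\<close>

lemma reach_saving_mono:
  assumes fin: "finite S" "finite F" "finite F'"
    and sub: "induced_edges F (insert s S) \<subseteq> F'"
  shows "reach_saving s c B F S \<le> reach_saving s c B F' S"
proof -
  let ?R = "affordable_reach s c B F S" and ?R' = "affordable_reach s c B F' S"
  have RR: "?R \<subseteq> ?R'" using sub by (intro affordable_reach_mono) auto
  have finR: "finite ?R'" using fin affordable_reach_subset[of s c B F' S] finite_subset by blast
  have s: "s \<in> ?R" by (rule affordable_reach.source)
  \<comment> \<open>Growing the tree on \<open>s\<close> alone shows that \<open>?R\<close> has a
    spanning tree at all, as attaining the minimum requires.\<close>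
  obtain T0 where "spanning_tree F ?R T0"
    using spanning_tree_extend[OF fin(1,2) spanning_tree_singleton[of F s]] s by blast
  then obtain T where T: "spanning_tree F ?R T" "sum c T = mst_cost c F ?R"
    using mst_cost_attained[OF fin(2)] by metis
  have "induced_edges F ?R \<subseteq> induced_edges F' ?R"
    using sub affordable_reach_subset[of s c B F S] by (auto simp: induced_edges_def)
  then have "spanning_tree F' ?R T" using T by (auto simp: spanning_tree_def)
  then obtain T' where T': "spanning_tree F' ?R' T'" "sum c T' \<le> sum c T + sum B (?R' - ?R)"
    using spanning_tree_extend[OF fin(1,3)] s RR by metis
  have "?R' - {s} = (?R - {s}) \<union> (?R' - ?R)" using s RR by auto
  moreover have "finite ?R" using RR finR finite_subset by blast
  ultimately have "sum B (?R' - {s}) = sum B (?R - {s}) + sum B (?R' - ?R)"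
    using finR by (auto intro: sum.union_disjoint)
  with T T' mst_cost_le[OF fin(3) T'(1), of c] show ?thesis
    unfolding reach_saving_def by linarith
qed

text \<open>The carrier property in the shape that \<open>shapley_carrier\<close> asks for, with
  \<open>s\<close> excluded from the players.\<close>

lemma reach_saving_restrict:
  assumes "S \<subseteq> S'" "s \<notin> S"
  shows "reach_saving s c B F (S \<inter> (affordable_reach s c B F S' - {s})) = reach_saving s c B F S"
proof -
  have "S \<inter> (affordable_reach s c B F S' - {s}) = S \<inter> affordable_reach s c B F S'"
    using assms by auto
  then show ?thesis using affordable_reach_restrict[OF assms(1), of s c B F]
    by (simp add: reach_saving_def)
qed

section \<open>Truthfulness: comparing two reports of one node\<close>

theorem theorem5p3:
  fixes V :: "'a set" and s :: 'a and E :: "'a set set"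
    and c :: "'a set \<Rightarrow> real" and B :: "'a \<Rightarrow> real"
    and g :: "('a \<Rightarrow> 'a set set) \<Rightarrow> 'a set" and f :: "('a \<Rightarrow> 'a set set) \<Rightarrow> 'a set set"
    and x :: "('a \<Rightarrow> 'a set set) \<Rightarrow> 'a \<Rightarrow> real"
  assumes "budgeted_graph V s E c B"
    and "SCSM V s E c B g f x"
  shows "\<forall>i\<in>V. \<forall>\<theta>\<^sub>i\<in>types E i. \<forall>\<theta>\<^sub>i'\<in>types E i. \<forall>\<theta>'\<in>profiles_except V s E i.
    \<theta>\<^sub>i' \<subseteq> \<theta>\<^sub>i \<longrightarrow> i \<in> g (\<theta>'(i := \<theta>\<^sub>i)) \<inter> g (\<theta>'(i := \<theta>\<^sub>i')) \<longrightarrow>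
    x (\<theta>'(i := \<theta>\<^sub>i)) i \<le> x (\<theta>'(i := \<theta>\<^sub>i')) i"
proof (intro ballI impI)
  interpret budgeted_graph V s E c B by fact
  fix i t t' \<theta>
  assume i: "i \<in> V" and t: "t \<in> types E i" and t': "t' \<in> types E i"
    and \<theta>: "\<theta> \<in> profiles_except V s E i" and tt: "t' \<subseteq> t"
    and ig: "i \<in> g (\<theta>(i := t)) \<inter> g (\<theta>(i := t'))"
  obtain sel where sel: "selection_function V s E c B sel"
    and mech: "\<And>\<theta>. \<theta> \<in> profiles V s E \<Longrightarrow> g \<theta> = sel \<theta> V"
      "\<And>\<theta>. \<theta> \<in> profiles V s E \<Longrightarrow> i \<in> g \<theta> \<Longrightarrow>
        x \<theta> i = B i - shapley (g \<theta>) (saving s E c B sel \<theta>) i"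
    using assms(2) i unfolding SCSM_def by auto
  have prof: "\<theta>(i := r) \<in> profiles V s E" if "r \<in> types E i" for r
    using \<theta> that i unfolding profiles_def profiles_except_def
    by (auto simp: PiE_iff extensional_def)
  let ?F = "reported_edges E (\<theta>(i := t))" and ?F' = "reported_edges E (\<theta>(i := t'))"
  have "E \<subseteq> Pow (insert s V)" using edges by auto
  then have "finite E" using finite_V finite_subset by auto
  then have finF: "finite (reported_edges E \<eta>)" for \<eta>
    by (rule finite_subset[rotated]) (auto simp: reported_edges_def)
  \<comment> \<open>This removes every dependence on how \<open>sel\<close> breaks ties.\<close>
  have sel_eq: "sel \<eta> S = affordable_reach s c B (reported_edges E \<eta>) S - {s}"
    if "\<eta> \<in> profiles V s E" "S \<subseteq> V" for \<eta> S
    using sel that selection_output_eq unfolding selection_function_def by metis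
  have saving_eq: "saving s E c B sel \<eta> S = reach_saving s c B (reported_edges E \<eta>) S"
    if "\<eta> \<in> profiles V s E" "S \<subseteq> V" for \<eta> S
    using sel_eq[OF that] affordable_reach.source[of s c B "reported_edges E \<eta>" S]
    by (simp add: saving_def reach_saving_def insert_absorb)
  have x_eq: "x (\<theta>(i := r)) i = B i - shapley A (reach_saving s c B (reported_edges E (\<theta>(i := r)))) i"
    if r: "r \<in> types E i" "i \<in> g (\<theta>(i := r))"
      and A: "A = affordable_reach s c B (reported_edges E (\<theta>(i := r))) V - {s}" for r A
  proof -
    have gA: "g (\<theta>(i := r)) = A" using mech(1) sel_eq prof[OF r(1)] A by simp
    have "A \<subseteq> V" unfolding A using affordable_reach_subset[of s c B _ V] by auto
    \<comment> \<open>The two savings are known to agree only on subsets of \<open>V\<close>, so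
      they are exchanged termwise inside the Shapley sum.\<close>
    then have "shapley A (saving s E c B sel (\<theta>(i := r))) i
        = shapley A (reach_saving s c B (reported_edges E (\<theta>(i := r)))) i"
      unfolding shapley_def using r gA
      by (intro sum.cong refl arg_cong2[where f = "(*)"] arg_cong2[where f = "(-)"]
            saving_eq prof) auto
    with mech(2)[OF prof[OF r(1)] r(2)] gA show ?thesis by simp
  qed
  define A where "A = affordable_reach s c B ?F V - {s}"
  define A' where "A' = affordable_reach s c B ?F' V - {s}"
  have F'F: "?F' \<subseteq> ?F" using tt by (fastforce simp: reported_edges_def)
  have AV: "A \<subseteq> V" unfolding A_def using affordable_reach_subset[of s c B ?F V] by auto
  have AA: "A' \<subseteq> A"
    unfolding A_def A'_def using F'F affordable_reach_mono[of V V ?F' s ?F c B]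
    by (auto simp: induced_edges_def)
  have iA: "i \<in> A'" using ig mech(1)[OF prof[OF t']] sel_eq[OF prof[OF t']] by (simp add: A'_def)
  have finS: "finite S" if "S \<subseteq> A" for S using that AV finite_V by (meson finite_subset)
  \<comment> \<open>Without \<open>i\<close> in the coalition, and with \<open>i\<close> distinct
    from \<open>s\<close>, no edge at \<open>i\<close> lies inside \<open>insert s S\<close>; all
    other reports coincide. Together with \<open>more\<close> below this gives equality.\<close>
  have same: "reach_saving s c B ?F S \<le> reach_saving s c B ?F' S" if "S \<subseteq> A - {i}" for S
  proof (rule reach_saving_mono)
    have "i \<notin> insert s S" using that i source by auto
    then show "induced_edges ?F (insert s S) \<subseteq> ?F'"
      by (fastforce simp: induced_edges_def reported_edges_def)
  qed (use that finS finF in auto)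
  have more: "reach_saving s c B ?F' S \<le> reach_saving s c B ?F S" if "S \<subseteq> A" for S
    using F'F that by (intro reach_saving_mono finS finF) (auto simp: induced_edges_def)
  \<comment> \<open>Under the smaller report \<open>A'\<close> is a carrier, so its game can be
    played on \<open>A\<close> as well. Both Shapley values then range over the same coalitions and
    can be compared termwise.\<close>
  have "shapley A' (reach_saving s c B ?F') i = shapley A (reach_saving s c B ?F') i"
  proof (rule shapley_carrier[symmetric])
    fix S assume "S \<subseteq> A"
    then show "reach_saving s c B ?F' (S \<inter> A') = reach_saving s c B ?F' S"
      unfolding A'_def using AV source by (intro reach_saving_restrict) auto
  qed (use AA iA finS in auto)
  also have "\<dots> \<le> shapley A (reach_saving s c B ?F) i"
  proof (rule shapley_mono)
    fix S assume "S \<subseteq> A - {i}"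
    moreover from this have "S \<union> {i} \<subseteq> A" using AA iA by auto
    ultimately show "reach_saving s c B ?F' (S \<union> {i}) - reach_saving s c B ?F' S
        \<le> reach_saving s c B ?F (S \<union> {i}) - reach_saving s c B ?F S"
      using same[of S] more[of "S \<union> {i}"] by linarith
  qed
  finally show "x (\<theta>(i := t)) i \<le> x (\<theta>(i := t')) i"
    using x_eq[OF t _ A_def] x_eq[OF t' _ A'_def] ig by simp
qed

end
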